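(* Suppose that $E$ and $F$ are ordered Banach spaces, $C$ is an open convex subset of $E$ and $\Phi:C\to F$ is a differentiable convex function whose differential is isotone on $C$. If $\mathbf{x}_1,\mathbf{x}_2,\mathbf{y}_1,\mathbf{y}_2$ are points in $C$ such that $\mathbf{y}_2\le\mathbf{x}_2\le\mathbf{x}_1\le\mathbf{y}_1$ and $(\mathbf{x}_1+\mathbf{x}_2)/2=(\mathbf{y}_1+\mathbf{y}_2)/2$, then $$\Phi(\mathbf{x}_1)+\Phi(\mathbf{x}_2)\le\Phi(\mathbf{y}_1)+\Phi(\mathbf{y}_2).$$
   Context: An ordered Banach space is a real Banach space $E$ with the partial order $\mathbf{x}\le\mathbf{y}\iff\mathbf{y}-\mathbf{x}\in E_+$ given by a closed proper convex cone $E_+$. Differentiable means Gâteaux differentiable, with $\Phi'(\mathbf{a}):E\to F$ a bounded linear operator. Convexity of $\Phi$ is with respect to the order of $F$: $\Phi((1-\lambda)\mathbf{x}+\lambda\mathbf{y})\le(1-\lambda)\Phi(\mathbf{x})+\lambda\Phi(\mathbf{y})$. The differential is isotone on $C$ if $\mathbf{a}\le\mathbf{b}$ in $C$ implies $\Phi'(\mathbf{a})\mathbf{v}\le\Phi'(\mathbf{b})\mathbf{v}$ for all $\mathbf{v}\in E_+$. *)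

theory Defs
  imports "HOL-Analysis.Analysis"
begin

text \<open>The positive cone of an ordered Banach space is \<open>{x. 0 \<le> x}\<close>.  The vector space orders of class
  \<^class>\<open>ordered_real_vector\<close> are exactly those induced by a convex cone \<open>P\<close> that is proper, i.e.
  \<open>P \<inter> - P = {0}\<close> (antisymmetry); see the lemmas below for both directions.  Neither normality of
  the cone nor \<open>E = P - P\<close> is required.\<close>

class ordered_banach = banach + ordered_real_vector +
  assumes closed_nonneg: "closed {x. 0 \<le> x}"

lemma ordered_banach_cone:
  fixes P :: "'a::ordered_banach set"
  defines "P \<equiv> {x. 0 \<le> x}"
  shows "closed P" "convex_cone P" "P \<inter> uminus ` P = {0}" "x \<le> y \<longleftrightarrow> y - x \<in> P"
proof -
  show "closed P"
    unfolding P_def by (rule closed_nonneg)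
  show "convex_cone P"
    unfolding P_def convex_cone_iff by (auto intro: exI[of _ 0] scaleR_nonneg_nonneg)
  show "P \<inter> uminus ` P = {0}"
    unfolding P_def by force
  show "x \<le> y \<longleftrightarrow> y - x \<in> P"
    unfolding P_def by simp
qed

lemma proper_cone_ordered_real_vector:
  fixes P :: "'a::real_vector set"
  assumes "convex_cone P" and "P \<inter> uminus ` P = {0}"
  shows "class.ordered_real_vector (+) (0::'a) (-) uminus
           (\<lambda>x y. y - x \<in> P) (\<lambda>x y. y - x \<in> P \<and> x \<noteq> y) scaleR"
proof -
  have zero: "0 \<in> P"
    and add: "x \<in> P \<Longrightarrow> y \<in> P \<Longrightarrow> x + y \<in> P"
    and scale: "x \<in> P \<Longrightarrow> 0 \<le> c \<Longrightarrow> c *\<^sub>R x \<in> P" for x y c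
    using assms(1) by (auto simp: convex_cone_iff convex_cone_contains_0)
  have anti: "x = y" if "y - x \<in> P" "x - y \<in> P" for x y
  proof -
    have "y - x \<in> P \<inter> uminus ` P"
      using that by (auto simp: image_iff intro!: bexI[of _ "x - y"])
    then show ?thesis
      using assms(2) by auto
  qed
  have trans: "z - x \<in> P" if "y - x \<in> P" "z - y \<in> P" for x y z
    using add[OF that] by (simp add: algebra_simps)
  have scale_left: "a *\<^sub>R y - a *\<^sub>R x \<in> P" if "y - x \<in> P" "0 \<le> a" for a x y
    using scale[OF that] by (simp add: scaleR_diff_right)
  have scale_right: "b *\<^sub>R x - a *\<^sub>R x \<in> P" if "a \<le> b" "x - 0 \<in> P" for a b x
    using scale[of x "b - a"] that by (simp add: scaleR_diff_left)
  show ?thesis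
    by unfold_locales
      (auto simp: zero algebra_simps scaleR_add_right scaleR_add_left
        intro: anti trans scale_left scale_right)
qed

text \<open>The library's \<^const>\<open>convex_on\<close> is for real-valued functions only.\<close>

definition order_convex_on :: "'a::real_vector set \<Rightarrow> ('a \<Rightarrow> 'b::ordered_real_vector) \<Rightarrow> bool" where
  "order_convex_on C f \<longleftrightarrow> convex C \<and>
     (\<forall>x\<in>C. \<forall>y\<in>C. \<forall>l\<in>{0..1}.
        f ((1 - l) *\<^sub>R x + l *\<^sub>R y) \<le> (1 - l) *\<^sub>R f x + l *\<^sub>R f y)"

text \<open>If \<open>a\<close> lies in an open set, only the values of \<open>f\<close> on that set enter the limit.
  The derivative is unique.\<close>

definition has_gateaux_derivative ::
    "('a::real_normed_vector \<Rightarrow> 'b::real_normed_vector) \<Rightarrow> ('a \<Rightarrow> 'b) \<Rightarrow> 'a \<Rightarrow> bool" where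
  "has_gateaux_derivative f f' a \<longleftrightarrow> bounded_linear f' \<and>
     (\<forall>v. ((\<lambda>t. (f (a + t *\<^sub>R v) - f a) /\<^sub>R t) \<longlongrightarrow> f' v) (at 0))"

lemma has_gateaux_derivative_unique:
  assumes "has_gateaux_derivative f f' a" "has_gateaux_derivative f g' a"
  shows "f' = g'"
proof
  fix v
  show "f' v = g' v"
    using assms tendsto_unique[OF trivial_limit_at[of "0::real"]]
    unfolding has_gateaux_derivative_def by blast
qed

definition isotone_differential_on ::
    "'a::ordered_banach set \<Rightarrow> ('a \<Rightarrow> 'a \<Rightarrow> 'b::ordered_banach) \<Rightarrow> bool" where
  "isotone_differential_on C D \<longleftrightarrow>
     (\<forall>a\<in>C. \<forall>b\<in>C. a \<le> b \<longrightarrow> (\<forall>v\<ge>0. D a v \<le> D b v))"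

end

theory Submission
  imports Defs
begin

text \<open>A convex function lies above its tangents, also when its values lie in an ordered Banach space:
  the difference quotients of \<open>\<Phi>\<close> along a segment from \<open>a\<close> to \<open>b\<close> are bounded above by
  \<open>\<Phi> b - \<Phi> a\<close>, and the bound survives the limit because the positive cone is closed.  This is
  \<open>order_convex_on_above_tangent\<close>.

  Equality of the midpoints makes the outer pair arise from the inner one by shifts
  by opposite vectors, \<open>y1 = x1 + v\<close> and \<open>y2 = x2 - v\<close>, with \<open>v \<ge> 0\<close>.  The tangents at \<open>x1\<close> and
  \<open>x2\<close> bound the changes of \<open>\<Phi>\<close> below by \<open>D\<Phi> x1 v\<close> and \<open>- D\<Phi> x2 v\<close>.
  Since \<open>x2 \<le> x1\<close>, isotonicity of the differential makes the sum of these bounds nonnegative.\<close>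

lemma order_convex_on_above_tangent:
  fixes f :: "'a::real_normed_vector \<Rightarrow> 'b::ordered_banach"
  assumes convex: "order_convex_on C f"
    and deriv: "has_gateaux_derivative f f' a"
    and "a \<in> C" "b \<in> C"
  shows "f' (b - a) \<le> f b - f a"
proof -
  define q where "q t = (f (a + t *\<^sub>R (b - a)) - f a) /\<^sub>R t" for t
  have quotient_le: "q t \<le> f b - f a" if "0 < t" "t < 1" for t
  proof -
    have "f ((1 - t) *\<^sub>R a + t *\<^sub>R b) \<le> (1 - t) *\<^sub>R f a + t *\<^sub>R f b"
      using convex assms(3,4) that unfolding order_convex_on_def by auto
    then have "f (a + t *\<^sub>R (b - a)) - f a \<le> t *\<^sub>R (f b - f a)"
      by (simp add: algebra_simps)
    then have "(1 / t) *\<^sub>R (f (a + t *\<^sub>R (b - a)) - f a) \<le> (1 / t) *\<^sub>R (t *\<^sub>R (f b - f a))"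
      using that by (intro scaleR_left_mono) auto
    then show ?thesis
      using that by (simp add: q_def divide_inverse)
  qed
  have "(q \<longlongrightarrow> f' (b - a)) (at 0)"
    using deriv unfolding has_gateaux_derivative_def q_def by blast
  \<comment> \<open>Convexity controls the quotients for positive steps only.\<close>
  then have "(q \<longlongrightarrow> f' (b - a)) (at_right 0)"
    by (rule filterlim_mono) (auto simp: at_le)
  then have "((\<lambda>t. (f b - f a) - q t) \<longlongrightarrow> (f b - f a) - f' (b - a)) (at_right 0)"
    by (intro tendsto_intros)
  moreover have "\<forall>\<^sub>F t in at_right (0::real). (f b - f a) - q t \<in> {x. 0 \<le> x}"
    using eventually_at_right_real[OF zero_less_one]
    by (rule eventually_mono) (auto intro: quotient_le)
  ultimately have "(f b - f a) - f' (b - a) \<in> {x. 0 \<le> x}"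
    by (intro Lim_in_closed_set[OF closed_nonneg]) auto
  then show ?thesis
    by simp
qed

theorem corollary1:
  fixes C :: "'e::ordered_banach set"
    and \<Phi> :: "'e \<Rightarrow> 'f::ordered_banach"
    and D\<Phi> :: "'e \<Rightarrow> 'e \<Rightarrow> 'f"
    and x1 x2 y1 y2 :: 'e
  assumes "open C" and "convex C"
    and "\<And>a. a \<in> C \<Longrightarrow> has_gateaux_derivative \<Phi> (D\<Phi> a) a"
    and "order_convex_on C \<Phi>"
    and "isotone_differential_on C D\<Phi>"
    and "x1 \<in> C" and "x2 \<in> C" and "y1 \<in> C" and "y2 \<in> C"
    and "y2 \<le> x2" and "x2 \<le> x1" and "x1 \<le> y1"
    and "(x1 + x2) /\<^sub>R 2 = (y1 + y2) /\<^sub>R 2"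
  shows "\<Phi> x1 + \<Phi> x2 \<le> \<Phi> y1 + \<Phi> y2"
proof -
  define v where "v = y1 - x1"
  have "x1 + x2 = y1 + y2"
    using assms(13) by simp
  then have shift: "y2 - x2 = - v"
    by (simp add: v_def algebra_simps)
  have "D\<Phi> x1 v \<le> \<Phi> y1 - \<Phi> x1"
    unfolding v_def using assms(3,4,6,8) by (intro order_convex_on_above_tangent)
  moreover have "- D\<Phi> x2 v \<le> \<Phi> y2 - \<Phi> x2"
  proof -
    have deriv: "has_gateaux_derivative \<Phi> (D\<Phi> x2) x2"
      using assms(3,7) by blast
    then have "bounded_linear (D\<Phi> x2)"
      unfolding has_gateaux_derivative_def by blast
    then have "D\<Phi> x2 (y2 - x2) = - D\<Phi> x2 v"
      unfolding shift by (intro linear_neg bounded_linear.linear)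
    then show ?thesis
      using order_convex_on_above_tangent[OF assms(4) deriv assms(7,9)] by simp
  qed
  ultimately have "D\<Phi> x1 v - D\<Phi> x2 v \<le> (\<Phi> y1 - \<Phi> x1) + (\<Phi> y2 - \<Phi> x2)"
    using add_mono by fastforce
  moreover have "D\<Phi> x2 v \<le> D\<Phi> x1 v"
    using assms(5,6,7,11,12) unfolding isotone_differential_on_def v_def by simp
  ultimately have "0 \<le> (\<Phi> y1 - \<Phi> x1) + (\<Phi> y2 - \<Phi> x2)"
    by (meson diff_ge_0_iff_ge order_trans)
  also have "\<dots> = (\<Phi> y1 + \<Phi> y2) - (\<Phi> x1 + \<Phi> x2)"
    by (simp add: algebra_simps)
  finally show ?thesis
    by simp
qed

end
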